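(* Let $(M,\mu)$ be a complete metric space and let $V$ and $W$ be two non-empty closed subsets of $M$. Let $f,g:V\cup W\to V\cup W$ be two continuous self-mappings such that: (i) $f$ is sub-cyclic in $g$, that is, $f(V)\subseteq g(W)\subseteq W$ and $f(W)\subseteq g(V)\subseteq V$; (ii) there exists $q\in(0,1)$ such that $$\mu(f(x),f(y))\leq q\,\mu(g(x),g(y))\qquad\text{for all } x\in V \text{ and all } y\in W.$$ If $f$ and $g$ are compatible, then they have a unique common fixed point in $V\cap W$; that is, there is exactly one $z\in V\cap W$ with $f(z)=g(z)=z$.
   Context: Compatibility: two self-mappings $f,g:X\to X$ of a metric space $(X,\mu)$ are called compatible if $\lim_{n\to\infty}\mu\bigl(f(g(x_n)),g(f(x_n))\bigr)=0$ whenever $\{x_n\}$ is a sequence in $X$ such that $\lim_{n\to\infty}f(x_n)$ and $\lim_{n\to\infty}g(x_n)$ exist in $X$ and are equal. Here it is applied with $X=V\cup W$ equipped with the restriction of $\mu$. *)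

theory Defs
  imports "HOL-Analysis.Analysis"
begin

(* Compatibility of two self-maps of the metric space X (with the restricted metric).
   The common limit t is required to lie in X; f and g are only meaningful on X, so
   the definition is intended for maps with f ` X <= X and g ` X <= X. *)
definition compatible_on ::
    "'a::metric_space set \<Rightarrow> ('a \<Rightarrow> 'a) \<Rightarrow> ('a \<Rightarrow> 'a) \<Rightarrow> bool" where
  "compatible_on X f g \<longleftrightarrow>
     (\<forall>x :: nat \<Rightarrow> 'a. (\<forall>n. x n \<in> X) \<longrightarrow>
        (\<exists>t\<in>X. (\<lambda>n. f (x n)) \<longlonglongrightarrow> t \<and> (\<lambda>n. g (x n)) \<longlonglongrightarrow> t) \<longrightarrow>
        (\<lambda>n. dist (f (g (x n))) (g (f (x n)))) \<longlonglongrightarrow> 0)"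

definition sub_cyclic_in ::
    "('a \<Rightarrow> 'a) \<Rightarrow> ('a \<Rightarrow> 'a) \<Rightarrow> 'a set \<Rightarrow> 'a set \<Rightarrow> bool" where
  "sub_cyclic_in f g V W \<longleftrightarrow>
     f ` V \<subseteq> g ` W \<and> g ` W \<subseteq> W \<and> f ` W \<subseteq> g ` V \<and> g ` V \<subseteq> V"

end

theory Submission
  imports Defs
begin

text \<open>
  The argument is Jungck's variant of Banach's fixed point theorem. Since \<open>f\<close> maps \<open>V\<close> into
  \<open>g ` W\<close> and \<open>W\<close> into \<open>g ` V\<close>, there is a sequence \<open>x\<close> running alternately through \<open>V\<close> and \<open>W\<close>
  with \<open>g (x (n + 1)) = f (x n)\<close>. Consecutive terms lie on different sides, so the contraction
  condition applies to them and says that the steps of \<open>f (x n)\<close> shrink by the factor \<open>q\<close>. Hence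
  both \<open>f (x n)\<close> and \<open>g (x n)\<close> converge to one point \<open>t\<close>, which lies in \<open>V \<inter> W\<close> because infinitely
  many terms lie in each of these closed sets.

  Compatibility along \<open>x\<close>, together with continuity, makes \<open>t\<close> a coincidence point,
  \<open>f t = g t\<close>. Compatibility along the constant sequence \<open>t\<close> says that \<open>f\<close> and \<open>g\<close> commute at \<open>t\<close>,
  so the value \<open>w = f t\<close> is itself a coincidence point. Coincidence points on opposite sides
  have the same value under \<open>f\<close> (\<open>coincidence_values_eq\<close>); comparing \<open>w\<close> with \<open>t\<close> gives
  \<open>f w = w\<close>, and comparing two common fixed points gives uniqueness.
\<close>

lemma Cauchy_if_steps_contract:
  fixes s :: "nat \<Rightarrow> 'a::metric_space"
  assumes q: "0 \<le> q" "q < 1"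
    and step: "\<And>n. dist (s (Suc n)) (s (Suc (Suc n))) \<le> q * dist (s n) (s (Suc n))"
  shows "Cauchy s"
proof -
  define c where "c = dist (s 0) (s (Suc 0))"
  have c: "dist (s n) (s (Suc n)) \<le> c * q ^ n" for n
  proof (induction n)
    case (Suc n)
    have "q * dist (s n) (s (Suc n)) \<le> q * (c * q ^ n)"
      using Suc q by (intro mult_left_mono)
    with step[of n] show ?case by (simp add: mult_ac)
  qed (simp add: c_def)
  \<comment> \<open>The finite geometric sum, multiplied by \<open>1 - q\<close> to keep the induction free of division.\<close>
  have geo: "(1 - q) * dist (s n) (s (n + k)) \<le> c * q ^ n * (1 - q ^ k)" for n k
  proof (induction k)
    case (Suc k)
    have "dist (s n) (s (n + Suc k)) \<le> dist (s n) (s (n + k)) + c * q ^ (n + k)"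
      using dist_triangle[of "s n" "s (n + Suc k)" "s (n + k)"] c[of "n + k"] by simp
    then have "(1 - q) * dist (s n) (s (n + Suc k))
        \<le> (1 - q) * (dist (s n) (s (n + k)) + c * q ^ (n + k))"
      using q by (intro mult_left_mono) auto
    also have "\<dots> \<le> c * q ^ n * (1 - q ^ k) + (1 - q) * (c * q ^ (n + k))"
      using Suc by (simp add: distrib_left)
    also have "\<dots> = c * q ^ n * (1 - q ^ Suc k)"
      by (simp add: algebra_simps power_add)
    finally show ?case .
  qed simp
  have bound: "dist (s n) (s (n + k)) \<le> c / (1 - q) * q ^ n" for n k
  proof -
    have "c * q ^ n * (1 - q ^ k) \<le> c * q ^ n"
      using q by (simp add: c_def mult_left_le)
    with geo[of n k] q show ?thesis by (simp add: field_simps)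
  qed
  have "(\<lambda>n. c / (1 - q) * q ^ n) \<longlonglongrightarrow> 0"
    using q by (intro tendsto_mult_right_zero LIMSEQ_power_zero) auto
  show ?thesis
  proof (rule metric_CauchyI)
    fix e :: real assume "e > 0"
    then have "\<forall>\<^sub>F n in sequentially. c / (1 - q) * q ^ n < e / 2"
      using \<open>(\<lambda>n. c / (1 - q) * q ^ n) \<longlonglongrightarrow> 0\<close> by (intro order_tendstoD(2)[of _ 0]) auto
    then obtain N where N: "c / (1 - q) * q ^ N < e / 2"
      by (auto simp: eventually_sequentially)
    have near: "dist (s N) (s m) < e / 2" if "m \<ge> N" for m
      using le_less_trans[OF bound[of N "m - N"] N] that by simp
    show "\<exists>M. \<forall>m\<ge>M. \<forall>n\<ge>M. dist (s m) (s n) < e"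
      using dist_triangle_half_r[OF near near] by blast
  qed
qed

text \<open>
  At coincidence points the contraction condition bounds a distance by \<open>q < 1\<close> times itself.
\<close>

lemma coincidence_values_eq:
  fixes f g :: "'b \<Rightarrow> 'a::metric_space"
  assumes contr: "\<forall>x\<in>V. \<forall>y\<in>W. dist (f x) (f y) \<le> q * dist (g x) (g y)"
    and "q < 1" "a \<in> V" "b \<in> W" "f a = g a" "f b = g b"
  shows "f a = f b"
proof (rule ccontr)
  assume "f a \<noteq> f b"
  with \<open>q < 1\<close> have "q * dist (f a) (f b) < dist (f a) (f b)" by simp
  moreover have "dist (f a) (f b) \<le> q * dist (f a) (f b)"
    using contr \<open>a \<in> V\<close> \<open>b \<in> W\<close> \<open>f a = g a\<close> \<open>f b = g b\<close> by metis
  ultimately show False by simp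
qed

lemma alternating_sequence_exists:
  assumes "V \<noteq> {}" "f ` V \<subseteq> g ` W" "f ` W \<subseteq> g ` V"
  obtains x :: "nat \<Rightarrow> 'a" where
    "\<And>n. even n \<Longrightarrow> x n \<in> V" "\<And>n. odd n \<Longrightarrow> x n \<in> W" "\<And>n. g (x (Suc n)) = f (x n)"
proof -
  have "\<exists>x. \<forall>n. x n \<in> (if even n then V else W) \<and> g (x (Suc n)) = f (x n)"
  proof (rule dependent_nat_choice)
    show "\<exists>a. a \<in> (if even (0::nat) then V else W)"
      using \<open>V \<noteq> {}\<close> by auto
  next
    fix a and n :: nat
    assume "a \<in> (if even n then V else W)"
    then have "f a \<in> g ` (if even (Suc n) then V else W)"
      using assms(2,3) by (auto split: if_splits)
    then obtain b where "f a = g b" "b \<in> (if even (Suc n) then V else W)"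
      by (rule imageE)
    then show "\<exists>b. b \<in> (if even (Suc n) then V else W) \<and> g b = f a"
      by (intro exI[of _ b] conjI) (simp_all only:)
  qed
  then obtain x :: "nat \<Rightarrow> 'a" where
    x: "\<And>n. x n \<in> (if even n then V else W)" "\<And>n. g (x (Suc n)) = f (x n)"
    by blast
  show ?thesis
  proof (rule that)
    show "x n \<in> V" if "even n" for n
      using x(1)[of n] that by simp
    show "x n \<in> W" if "odd n" for n
      using x(1)[of n] that by simp
  qed (rule x(2))
qed

text \<open>
  For continuous maps, compatibility in the limit becomes the exact equality of \<open>f\<close> and \<open>g\<close> at
  the common limit: \<open>f (g (x n))\<close> tends to \<open>f t\<close> and \<open>g (f (x n))\<close> to \<open>g t\<close>, while their distance
  vanishes.
\<close>

lemma compatible_limit_coincidence: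
  assumes comp: "compatible_on X f g"
    and cont: "continuous_on X f" "continuous_on X g"
    and maps: "f ` X \<subseteq> X" "g ` X \<subseteq> X"
    and x: "\<And>n. x n \<in> X" and t: "t \<in> X"
    and lim: "(\<lambda>n. f (x n)) \<longlonglongrightarrow> t" "(\<lambda>n. g (x n)) \<longlonglongrightarrow> t"
  shows "f t = g t"
proof -
  have "(\<lambda>n. f (g (x n))) \<longlonglongrightarrow> f t" "(\<lambda>n. g (f (x n))) \<longlonglongrightarrow> g t"
    using x maps by (auto intro!: continuous_on_tendsto_compose[OF cont(1) lim(2) t]
        continuous_on_tendsto_compose[OF cont(2) lim(1) t] always_eventually)
  then have "(\<lambda>n. dist (f (g (x n))) (g (f (x n)))) \<longlonglongrightarrow> dist (f t) (g t)"
    by (rule tendsto_dist)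
  moreover have "(\<lambda>n. dist (f (g (x n))) (g (f (x n)))) \<longlonglongrightarrow> 0"
    using comp x t lim unfolding compatible_on_def by blast
  ultimately have "dist (f t) (g t) = 0"
    by (rule LIMSEQ_unique)
  then show ?thesis by simp
qed

lemma compatible_commute_at_coincidence:
  assumes "compatible_on X f g" "t \<in> X" "f t \<in> X" "f t = g t"
  shows "f (g t) = g (f t)"
proof -
  have "(\<lambda>n::nat. dist (f (g t)) (g (f t))) \<longlonglongrightarrow> 0"
    using assms(1)[unfolded compatible_on_def, rule_format, of "\<lambda>_. t"] assms(2-4)
    by auto
  then show ?thesis by (simp add: LIMSEQ_const_iff)
qed

theorem theorem2p10:
  fixes V W :: "'a::complete_space set"
    and f g :: "'a \<Rightarrow> 'a"
  assumes "closed V" and "V \<noteq> {}"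
    and "closed W" and "W \<noteq> {}"
    and "f ` (V \<union> W) \<subseteq> V \<union> W" and "g ` (V \<union> W) \<subseteq> V \<union> W"
    and "continuous_on (V \<union> W) f" and "continuous_on (V \<union> W) g"
    and "sub_cyclic_in f g V W"
    and "\<exists>q::real. 0 < q \<and> q < 1 \<and>
           (\<forall>x\<in>V. \<forall>y\<in>W. dist (f x) (f y) \<le> q * dist (g x) (g y))"
    and "compatible_on (V \<union> W) f g"
  shows "\<exists>!z. z \<in> V \<inter> W \<and> f z = z \<and> g z = z"
proof -
  obtain q where q: "0 < q" "q < 1"
    and contr: "\<forall>x\<in>V. \<forall>y\<in>W. dist (f x) (f y) \<le> q * dist (g x) (g y)"
    using assms(10) by blast
  have cyc: "f ` V \<subseteq> g ` W" "f ` W \<subseteq> g ` V" and "g ` W \<subseteq> W" "g ` V \<subseteq> V"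
    using \<open>sub_cyclic_in f g V W\<close> unfolding sub_cyclic_in_def by simp_all
  then have sides: "f ` V \<subseteq> W" "f ` W \<subseteq> V"
    by (simp_all only: subset_trans[OF cyc(1)] subset_trans[OF cyc(2)])
  obtain x where xV: "\<And>n. even n \<Longrightarrow> x n \<in> V" and xW: "\<And>n. odd n \<Longrightarrow> x n \<in> W"
    and gx: "\<And>n. g (x (Suc n)) = f (x n)"
    using alternating_sequence_exists[OF \<open>V \<noteq> {}\<close> cyc] by blast
  \<comment> \<open>The contraction condition wants the point of \<open>V\<close> first, hence the case split on parity.\<close>
  have "dist (f (x (Suc n))) (f (x (Suc (Suc n)))) \<le> q * dist (f (x n)) (f (x (Suc n)))" for n
  proof (cases "even n")
    case True
    then show ?thesis
      using contr[rule_format, OF xV xW, of "Suc (Suc n)" "Suc n"] by (simp add: gx dist_commute)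
  next
    case False
    then show ?thesis
      using contr[rule_format, OF xV xW, of "Suc n" "Suc (Suc n)"] by (simp add: gx)
  qed
  then have "Cauchy (\<lambda>n. f (x n))"
    using q by (intro Cauchy_if_steps_contract[of q]) auto
  then obtain t where ft: "(\<lambda>n. f (x n)) \<longlonglongrightarrow> t"
    using Cauchy_convergent_iff convergent_def by blast
  then have "(\<lambda>n. g (x (Suc n))) \<longlonglongrightarrow> t"
    by (simp add: gx)
  then have gt: "(\<lambda>n. g (x n)) \<longlonglongrightarrow> t"
    by (rule LIMSEQ_imp_Suc)
  \<comment> \<open>\<open>f\<close> swaps the sides, so the odd subsequence of \<open>f (x n)\<close> lies in \<open>V\<close>, the even one in \<open>W\<close>.\<close>
  have "(\<lambda>n. f (x (2 * n + 1))) \<longlonglongrightarrow> t"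
    using LIMSEQ_subseq_LIMSEQ[OF ft, of "\<lambda>n. 2 * n + 1"] by (simp add: strict_mono_def o_def)
  moreover have "f (x (2 * n + 1)) \<in> V" for n
    using xW[of "2 * n + 1"] sides by auto
  ultimately have tV: "t \<in> V"
    using closed_sequentially[OF \<open>closed V\<close>, of "\<lambda>n. f (x (2 * n + 1))"] by blast
  have "(\<lambda>n. f (x (2 * n))) \<longlonglongrightarrow> t"
    using LIMSEQ_subseq_LIMSEQ[OF ft, of "\<lambda>n. 2 * n"] by (simp add: strict_mono_def o_def)
  moreover have "f (x (2 * n)) \<in> W" for n
    using xV[of "2 * n"] sides by auto
  ultimately have tW: "t \<in> W"
    using closed_sequentially[OF \<open>closed W\<close>, of "\<lambda>n. f (x (2 * n))"] by blast
  have "x n \<in> V \<union> W" for n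
    using xV xW by blast
  then have coin: "f t = g t"
    using compatible_limit_coincidence[OF assms(11,7,8,5,6) _ _ ft gt] tV by blast
  define w where "w = f t"
  have wVW: "w \<in> V" "w \<in> W"
    using sides tV tW unfolding w_def by auto
  have "f w = g w"
    using compatible_commute_at_coincidence[OF assms(11) _ _ coin] tV wVW coin
    unfolding w_def by simp
  then have "f w = w"
    using coincidence_values_eq[OF contr \<open>q < 1\<close> \<open>w \<in> V\<close> tW _ coin] unfolding w_def by simp
  show ?thesis
  proof (rule ex1I[of _ w])
    show "w \<in> V \<inter> W \<and> f w = w \<and> g w = w"
      using wVW \<open>f w = w\<close> \<open>f w = g w\<close> by simp
  next
    fix z assume z: "z \<in> V \<inter> W \<and> f z = z \<and> g z = z"
    then have "z \<in> V" "f z = g z"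
      by simp_all
    have "z = f z"
      using z by simp
    also have "f z = f w"
      using \<open>z \<in> V\<close> \<open>w \<in> W\<close> \<open>f z = g z\<close> \<open>f w = g w\<close>
      by (rule coincidence_values_eq[OF contr \<open>q < 1\<close>])
    also note \<open>f w = w\<close>
    finally show "z = w" .
  qed
qed

end
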